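(* Let $a,b\in\mathbb{R}$ with $a^2<b^2$, let $G$ be the Green's function of the problem $u'(t)+a\,u(-t)+b\,u(t)=h(t)$ for a.e. $t\in\mathbb{R}$, $u(t_0)=c$ (given in the context), and define $$\sigma(a,b):=\frac{1}{\sqrt{b^2-a^2}}\operatorname{arctanh}\frac{\sqrt{b^2-a^2}}{b}.$$ Then: (i) if $0<a<b$, $G$ is non-negative on $[0,\sigma(a,b)]\times\mathbb{R}$; (ii) if $b<-a<0$, $G$ is non-negative on $[0,+\infty)\times\mathbb{R}$; (iii) if $b<a<0$, $G$ is non-positive on $[\sigma(a,b),0]\times\mathbb{R}$; (iv) if $b>-a>0$, $G$ is non-positive on $(-\infty,0]\times\mathbb{R}$; (v) $G$ changes sign in any other strip not a subset of the aforementioned.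
   Context: Here $h\in L^1_{\mathrm{loc}}(\mathbb{R})$ and $t_0,c\in\mathbb{R}$. Strips are sets of the kind $[\alpha,\beta]\times\mathbb{R}$ in the $(t,s)$-plane (unbounded intervals as in (ii) and (iv) also occurring). For $t_1,t_2\in\mathbb{R}$ the oriented characteristic function is $\chi_{t_1}^{t_2}(t)=1$ if $t_1\le t\le t_2$, $\chi_{t_1}^{t_2}(t)=-1$ if $t_2\le t<t_1$, and $0$ otherwise. The Green's function is $$G(t,s)=\tfrac12\Big(\big[\tilde u(-s)\tilde v(t)+\tilde v(-s)\tilde u(t)\big]\chi_0^t(s)+\big[\tilde u(-s)\tilde v(t)-\tilde v(-s)\tilde u(t)\big]\chi_{-t}^0(s)\Big),\quad t,s\in\mathbb{R},$$ where $\tilde u'(t)+a\tilde u(-t)+b\tilde u(t)=0$, $\tilde u(0)=1$ and $\tilde v'(t)-a\tilde v(-t)+b\tilde v(t)=0$, $\tilde v(0)=1$. For $a^2<b^2$ and $\omega=\sqrt{b^2-a^2}$ it is $$G(t,s)=\Big[\cosh(\omega(s-t))+\frac b\omega\sinh(\omega(s-t))\Big]\chi_0^t(s)+\frac a\omega\sinh(\omega(s+t))\,\chi_{-t}^0(s),$$ which is rewritten as: $\cosh\omega(s-t)+\frac b\omega\sinh\omega(s-t)$ for $0\le s\le t$; $-\cosh\omega(s-t)-\frac b\omega\sinh\omega(s-t)$ for $t\le s\le 0$; $\frac a\omega\sinh\omega(s+t)$ for $-t\le s\le 0$; $-\frac a\omega\sinh\omega(s+t)$ for $0\le s\le -t$;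 and $0$ otherwise.
   Formalization: In (iii) and (iv) the point (t,s)=(0,0) is removed, since the convention for χ gives G(0,0)=1>0; in (v) the sign change is shown off that point, and a=0 is excluded, where σ(a,b) is undefined and (v) fails, e.g. on [0,1]×ℝ. *)

theory Defs
  imports "HOL-Analysis.Analysis"
begin

definition oriented_char :: "real \<Rightarrow> real \<Rightarrow> real \<Rightarrow> real" where
  "oriented_char t1 t2 t =
     (if t1 \<le> t \<and> t \<le> t2 then 1 else if t2 \<le> t \<and> t < t1 then -1 else 0)"

definition reflection_solution :: "real \<Rightarrow> real \<Rightarrow> (real \<Rightarrow> real) \<Rightarrow> bool" where
  "reflection_solution a b u \<longleftrightarrow>
     (\<forall>t. u differentiable at t \<and> deriv u t + a * u (- t) + b * u t = 0) \<and> u 0 = 1"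

text \<open>The Green's function of \<open>u'(t) + a u(-t) + b u(t) = h(t)\<close>, \<open>u(t\<^sub>0) = c\<close>, in terms of
  the solutions \<open>u\<close> for \<open>(a, b)\<close> and \<open>v\<close> for \<open>(-a, b)\<close> of \<^const>\<open>reflection_solution\<close>.
  It does not depend on \<open>h\<close>, \<open>t\<^sub>0\<close>, \<open>c\<close>.\<close>

definition greens_function ::
    "(real \<Rightarrow> real) \<Rightarrow> (real \<Rightarrow> real) \<Rightarrow> real \<Rightarrow> real \<Rightarrow> real" where
  "greens_function u v t s =
     1 / 2 * ((u (- s) * v t + v (- s) * u t) * oriented_char 0 t s
            + (u (- s) * v t - v (- s) * u t) * oriented_char (- t) 0 s)"

text \<open>Pitfall: \<^term>\<open>oriented_char 0 0\<close> is the indicator of \<open>{0}\<close>, so the value of the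
  Green's function at the single point \<open>(0, 0)\<close> is 1 for all parameters, even if it is
  non-positive at all other points \<open>(t, s)\<close> with \<open>t \<le> 0\<close>. This is an artefact of the
  endpoint convention (a null set in \<open>s\<close>), so non-positivity and changes of sign
  are to be considered off the origin.\<close>

lemma greens_function_origin:
  assumes "u 0 = 1" "v 0 = 1"
  shows "greens_function u v 0 0 = 1"
  using assms by (simp add: greens_function_def oriented_char_def)

lemma reflection_solution_exists:
  assumes "a\<^sup>2 < b\<^sup>2"
  shows "\<exists>u. reflection_solution a b u"
proof -
  define w where "w = sqrt (b\<^sup>2 - a\<^sup>2)"
  have w: "w \<noteq> 0" and w2: "w * w = b * b - a * a"
    using assms by (auto simp: w_def power2_eq_square)
  define u where "u = (\<lambda>t. cosh (w * t) - (a + b) / w * sinh (w * t))"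
  have d: "(u has_real_derivative w * sinh (w * t) - (a + b) * cosh (w * t)) (at t)" for t
    unfolding u_def using w by (auto intro!: derivative_eq_intros)
  have "w * sinh (w * t) - (a + b) * cosh (w * t) + a * u (- t) + b * u t
      = (w * w - (b * b - a * a)) / w * sinh (w * t)" for t
    unfolding u_def using w by (simp add: field_simps)
  then have "deriv u t + a * u (- t) + b * u t = 0" for t
    using DERIV_imp_deriv[OF d, of t] w2 by simp
  moreover have "u differentiable at t" for t
    using d real_differentiable_def by blast
  moreover have "u 0 = 1"
    by (simp add: u_def)
  ultimately show ?thesis
    unfolding reflection_solution_def by blast
qed

text \<open>Only meaningful for \<open>a \<noteq> 0\<close>: for \<open>a = 0\<close> the argument of \<^const>\<open>artanh\<close> is \<open>1\<close> or \<open>-1\<close>.\<close>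

definition sigma_refl :: "real \<Rightarrow> real \<Rightarrow> real" where
  "sigma_refl a b = 1 / sqrt (b\<^sup>2 - a\<^sup>2) * artanh (sqrt (b\<^sup>2 - a\<^sup>2) / b)"

definition strip :: "(real \<times> real) set \<Rightarrow> bool" where
  "strip S \<longleftrightarrow> (\<exists>T. S = T \<times> UNIV \<and>
     ((\<exists>\<alpha> \<beta>. \<alpha> \<le> \<beta> \<and> T = {\<alpha>..\<beta>}) \<or> (\<exists>\<alpha>. T = {\<alpha>..}) \<or> (\<exists>\<beta>. T = {..\<beta>}) \<or> T = UNIV))"

definition nonneg_on :: "(real \<Rightarrow> real \<Rightarrow> real) \<Rightarrow> (real \<times> real) set \<Rightarrow> bool" where
  "nonneg_on G S \<longleftrightarrow> (\<forall>(t, s)\<in>S. 0 \<le> G t s)"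

definition nonpos_on :: "(real \<Rightarrow> real \<Rightarrow> real) \<Rightarrow> (real \<times> real) set \<Rightarrow> bool" where
  "nonpos_on G S \<longleftrightarrow> (\<forall>(t, s)\<in>S. G t s \<le> 0)"

definition changes_sign_on :: "(real \<Rightarrow> real \<Rightarrow> real) \<Rightarrow> (real \<times> real) set \<Rightarrow> bool" where
  "changes_sign_on G S \<longleftrightarrow> (\<exists>(t, s)\<in>S. 0 < G t s) \<and> (\<exists>(t, s)\<in>S. G t s < 0)"

end

theory Submission
  imports Defs
begin

text \<open>Write \<open>\<omega> = sqrt (b\<^sup>2 - a\<^sup>2)\<close>. The even and odd parts of a solution of the reflection
  problem satisfy a linear \<open>2 \<times> 2\<close> system with constant coefficients and eigenvalues
  \<open>\<plusminus>\<omega>\<close>, so the solutions are explicit hyperbolic functions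
  (\<open>reflection_solution_closed_form\<close>), and addition formulas turn the Green's function into
  \<open>K (t - s)\<close> on the triangles between the \<open>t\<close>-axis and the diagonal plus \<open>R (s + t)\<close> on the
  triangles between the \<open>t\<close>-axis and the antidiagonal (\<open>greens_function_closed_form\<close>), where
  \<open>K r = cosh (\<omega> r) - b / \<omega> sinh (\<omega> r)\<close> and \<open>R r = a / \<omega> sinh (\<omega> r)\<close>; both terms enter with
  the sign of \<open>t\<close>.

  Let \<open>a \<noteq> 0\<close>. The sign of \<open>R r\<close> is that of \<open>a r\<close>. The sign of \<open>K r\<close> is that of
  \<open>1 - b / \<omega> tanh (\<omega> r)\<close>; as \<open>tanh\<close> is increasing, \<open>K\<close> has exactly one zero, at \<open>\<sigma>(a, b)\<close>,
  which lies on the side of the origin given by the sign of \<open>b\<close>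
  (\<open>diagonal_kernel_neg_iff_pos\<close>, \<open>diagonal_kernel_neg_iff_neg\<close>). For fixed \<open>t\<close> the
  argument \<open>t - s\<close> runs through the interval between \<open>0\<close> and \<open>t\<close>, so for \<open>t \<noteq> 0\<close> the row of
  the Green's function at \<open>t\<close> has constant sign precisely if \<open>a\<close> and \<open>t\<close> have the same sign
  and \<open>\<sigma>(a, b)\<close> does not lie strictly between \<open>0\<close> and \<open>t\<close>; the row at \<open>0\<close> vanishes off the
  origin. A strip that is not contained in the given one contains a bad row, and a change of
  sign within that row suffices.\<close>

definition diagonal_kernel :: "real \<Rightarrow> real \<Rightarrow> real \<Rightarrow> real" where
  "diagonal_kernel a b r =
     cosh (sqrt (b\<^sup>2 - a\<^sup>2) * r) - b / sqrt (b\<^sup>2 - a\<^sup>2) * sinh (sqrt (b\<^sup>2 - a\<^sup>2) * r)"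

definition reflected_kernel :: "real \<Rightarrow> real \<Rightarrow> real \<Rightarrow> real" where
  "reflected_kernel a b r = a / sqrt (b\<^sup>2 - a\<^sup>2) * sinh (sqrt (b\<^sup>2 - a\<^sup>2) * r)"

section \<open>Closed forms\<close>

text \<open>With \<open>x t = u t + u (- t)\<close> and \<open>y t = u t - u (- t)\<close> the equation becomes
  \<open>x' = - (b - a) y\<close>, \<open>y' = - (a + b) x\<close>. Applying the inverse of the fundamental matrix of
  this system to \<open>(x, y)\<close> yields two constants, from which \<open>x\<close> and \<open>y\<close> are recovered by
  \<open>cosh\<^sup>2 - sinh\<^sup>2 = 1\<close>.\<close>

lemma reflection_solution_closed_form:
  assumes ab: "a\<^sup>2 < b\<^sup>2" and u: "reflection_solution a b u"
  shows "u t = cosh (sqrt (b\<^sup>2 - a\<^sup>2) * t)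
               - (a + b) / sqrt (b\<^sup>2 - a\<^sup>2) * sinh (sqrt (b\<^sup>2 - a\<^sup>2) * t)"
proof -
  define w where "w = sqrt (b\<^sup>2 - a\<^sup>2)"
  have w: "w \<noteq> 0" and w2: "w * w = (a + b) * (b - a)"
    using ab by (auto simp: w_def power2_eq_square algebra_simps)
  have du: "(u has_real_derivative - (a * u (- r) + b * u r)) (at r)" for r
  proof -
    have "deriv u r = - (a * u (- r) + b * u r)"
      using u unfolding reflection_solution_def by (simp add: algebra_simps eq_neg_iff_add_eq_0)
    then show ?thesis
      using u unfolding reflection_solution_def
      by (metis DERIV_deriv_iff_real_differentiable)
  qed
  have dm: "((\<lambda>r. u (- r)) has_real_derivative a * u r + b * u (- r)) (at r)" for r
    using DERIV_mirror[of u "- (a * u r + b * u (- r))" r] du[of "- r"]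
    by (simp add: add.commute)
  define x where "x r = u r + u (- r)" for r
  define y where "y r = u r - u (- r)" for r
  have dx: "(x has_real_derivative - ((b - a) * y r)) (at r)" for r
    unfolding x_def y_def
    by (rule DERIV_cong[OF DERIV_add[OF du dm]]) (simp add: algebra_simps)
  have dy: "(y has_real_derivative - ((a + b) * x r)) (at r)" for r
    unfolding x_def y_def
    by (rule DERIV_cong[OF DERIV_diff[OF du dm]]) (simp add: algebra_simps)
  have dc: "((\<lambda>r. cosh (w * r)) has_real_derivative w * sinh (w * r)) (at r)"
    and ds: "((\<lambda>r. sinh (w * r)) has_real_derivative w * cosh (w * r)) (at r)" for r
    by (auto intro!: derivative_eq_intros)
  define p where "p r = w * (x r * cosh (w * r)) + (b - a) * (y r * sinh (w * r))" for r
  define q where "q r = w * (y r * cosh (w * r)) + (a + b) * (x r * sinh (w * r))" for r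
  have "(p has_real_derivative 0) (at r)" for r
  proof -
    have "(p has_real_derivative
        w * (- ((b - a) * y r) * cosh (w * r) + w * sinh (w * r) * x r)
        + (b - a) * (- ((a + b) * x r) * sinh (w * r) + w * cosh (w * r) * y r)) (at r)"
      unfolding p_def
      by (intro DERIV_add DERIV_cmult DERIV_mult dx dy dc ds)
    moreover have "w * (- ((b - a) * y r) * cosh (w * r) + w * sinh (w * r) * x r)
        + (b - a) * (- ((a + b) * x r) * sinh (w * r) + w * cosh (w * r) * y r)
        = (w * w - (a + b) * (b - a)) * (x r * sinh (w * r))"
      by (simp add: algebra_simps)
    ultimately show ?thesis by (simp add: w2)
  qed
  then have "p t = p 0" using DERIV_isconst_all by blast
  moreover have "(q has_real_derivative 0) (at r)" for r
  proof -
    have "(q has_real_derivative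
        w * (- ((a + b) * x r) * cosh (w * r) + w * sinh (w * r) * y r)
        + (a + b) * (- ((b - a) * y r) * sinh (w * r) + w * cosh (w * r) * x r)) (at r)"
      unfolding q_def
      by (intro DERIV_add DERIV_cmult DERIV_mult dx dy dc ds)
    moreover have "w * (- ((a + b) * x r) * cosh (w * r) + w * sinh (w * r) * y r)
        + (a + b) * (- ((b - a) * y r) * sinh (w * r) + w * cosh (w * r) * x r)
        = (w * w - (a + b) * (b - a)) * (y r * sinh (w * r))"
      by (simp add: algebra_simps)
    ultimately show ?thesis by (simp add: w2)
  qed
  then have "q t = q 0" using DERIV_isconst_all by blast
  moreover have "u 0 = 1" using u by (simp add: reflection_solution_def)
  ultimately have
    pt: "w * (x t * cosh (w * t)) + (b - a) * (y t * sinh (w * t)) = 2 * w" and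
    qt: "w * (y t * cosh (w * t)) + (a + b) * (x t * sinh (w * t)) = 0"
    by (simp_all add: p_def q_def x_def y_def)
  let ?c = "cosh (w * t)" and ?s = "sinh (w * t)"
  have cs: "?c * ?c - ?s * ?s = 1"
    using cosh_square_eq[of "w * t"] by (simp add: power2_eq_square)
  have "w * w * (x t * (?c * ?c - ?s * ?s))
      = w * ?c * (w * (x t * ?c) + (b - a) * (y t * ?s))
        - (b - a) * ?s * (w * (y t * ?c) + (a + b) * (x t * ?s))
        + ((a + b) * (b - a) - w * w) * (x t * ?s * ?s)"
    by (simp add: algebra_simps)
  then have xt: "x t = 2 * ?c"
    unfolding pt qt cs w2[symmetric] using w by simp
  have "w * w * (y t * (?c * ?c - ?s * ?s))
      = w * ?c * (w * (y t * ?c) + (a + b) * (x t * ?s))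
        - (a + b) * ?s * (w * (x t * ?c) + (b - a) * (y t * ?s))
        + ((a + b) * (b - a) - w * w) * (y t * ?s * ?s)"
    by (simp add: algebra_simps)
  then have "w * (w * y t) = w * (- 2 * (a + b) * ?s)"
    unfolding pt qt cs w2[symmetric] by (simp add: algebra_simps)
  then have yt: "w * y t = - 2 * (a + b) * ?s" using w by simp
  have "w * (2 * u t) = w * x t + w * y t" by (simp add: x_def y_def algebra_simps)
  then show ?thesis
    unfolding w_def[symmetric] xt yt using w by (simp add: field_simps)
qed

lemma greens_function_closed_form:
  assumes ab: "a\<^sup>2 < b\<^sup>2"
    and u: "reflection_solution a b u" and v: "reflection_solution (- a) b v"
  shows "greens_function u v t s =
    diagonal_kernel a b (t - s) * oriented_char 0 t s
    + reflected_kernel a b (s + t) * oriented_char (- t) 0 s"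
proof -
  define w where "w = sqrt (b\<^sup>2 - a\<^sup>2)"
  have w: "w \<noteq> 0" and w2: "w * w = (a + b) * (b - a)"
    using ab by (auto simp: w_def power2_eq_square algebra_simps)
  have ue: "u r = cosh (w * r) - (a + b) / w * sinh (w * r)" for r
    using reflection_solution_closed_form[OF ab u] by (simp add: w_def)
  have ve: "v r = cosh (w * r) - (b - a) / w * sinh (w * r)" for r
    using reflection_solution_closed_form[OF _ v] ab by (simp add: w_def)
  have pq: "(a + b) / w * ((b - a) / w) = 1"
    using w w2 by (simp add: field_simps)
  have split: "b / w = ((a + b) / w + (b - a) / w) / 2" "a / w = ((a + b) / w - (b - a) / w) / 2"
    by (simp_all flip: add_divide_distrib diff_divide_distrib)
  have sum: "((c + p * d) * (C - q * D) + (c + q * d) * (C - p * D)) / 2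
      = (c * C - p * q * (d * D)) + (p + q) / 2 * (d * C - c * D)"
    and diff: "((c + p * d) * (C - q * D) - (c + q * d) * (C - p * D)) / 2
      = (p - q) / 2 * (d * C + c * D)" for c d C D p q :: real
    by (simp_all add: field_simps)
  have "(u (- s) * v t + v (- s) * u t) / 2 = diagonal_kernel a b (t - s)"
    unfolding ue ve diagonal_kernel_def w_def[symmetric] split right_diff_distrib[of w]
      cosh_diff sinh_diff mult_minus_right cosh_minus sinh_minus diff_minus_eq_add sum pq
    by (simp add: algebra_simps)
  moreover have "(u (- s) * v t - v (- s) * u t) / 2 = reflected_kernel a b (s + t)"
    unfolding ue ve reflected_kernel_def w_def[symmetric] split distrib_left[of w]
      sinh_add mult_minus_right cosh_minus sinh_minus diff_minus_eq_add diff
    by simp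
  ultimately show ?thesis
    unfolding greens_function_def by (simp add: algebra_simps)
qed

section \<open>Signs of the two kernels\<close>

lemma diagonal_kernel_0 [simp]: "diagonal_kernel a b 0 = 1"
  by (simp add: diagonal_kernel_def)

lemma reflected_kernel_neg_iff:
  assumes "a\<^sup>2 < b\<^sup>2"
  shows "reflected_kernel a b r < 0 \<longleftrightarrow> a * r < 0"
  using assms by (auto simp: reflected_kernel_def zero_less_mult_iff zero_less_divide_iff
      divide_less_0_iff mult_less_0_iff)

lemma reflected_kernel_nonneg_iff:
  assumes "a\<^sup>2 < b\<^sup>2"
  shows "0 \<le> reflected_kernel a b r \<longleftrightarrow> 0 \<le> a * r"
  using reflected_kernel_neg_iff[OF assms, of r] by linarith

lemma tanh_artanh_real:
  fixes x :: real
  assumes "\<bar>x\<bar> < 1"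
  shows "tanh (artanh x) = x"
proof -
  have e: "exp (- 2 * artanh x) = (1 - x) / (1 + x)"
    using assms by (simp add: artanh_def exp_minus)
  show ?thesis
    using assms unfolding tanh_real_altdef e by (simp add: field_simps)
qed

text \<open>Dividing \<open>K r\<close> by the positive number \<open>cosh (\<omega> r)\<close> leaves \<open>1 - b / \<omega> tanh (\<omega> r)\<close>, so
  that the increasing function \<open>tanh\<close> is to be compared with \<open>\<omega> / b\<close>. For \<open>a \<noteq> 0\<close> this
  number lies in the range \<open>(-1, 1)\<close> of \<open>tanh\<close>.\<close>

lemma diagonal_kernel_neg_iff_pos:
  assumes ab: "a\<^sup>2 < b\<^sup>2" and "a \<noteq> 0" and b: "0 < b"
  shows "diagonal_kernel a b r < 0 \<longleftrightarrow> sigma_refl a b < r"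
proof -
  define w where "w = sqrt (b\<^sup>2 - a\<^sup>2)"
  have w: "0 < w" using ab by (simp add: w_def)
  have "w < b" using b \<open>a \<noteq> 0\<close> unfolding w_def by (intro real_less_lsqrt) auto
  then have range: "\<bar>w / b\<bar> < 1" using w b by simp
  have "diagonal_kernel a b r = cosh (w * r) * (1 - b / w * tanh (w * r))"
    unfolding diagonal_kernel_def w_def[symmetric] tanh_def by (simp add: field_simps)
  then have "diagonal_kernel a b r < 0 \<longleftrightarrow> 1 < b / w * tanh (w * r)"
    using mult_less_cancel_left_pos[OF cosh_real_pos[of "w * r"],
        of "1 - b / w * tanh (w * r)" 0] by simp
  also have "\<dots> \<longleftrightarrow> tanh (artanh (w / b)) < tanh (w * r)"
    using w b by (simp add: tanh_artanh_real[OF range] field_simps)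
  also have "\<dots> \<longleftrightarrow> sigma_refl a b < r"
    using w unfolding sigma_refl_def w_def[symmetric] by (simp add: field_simps)
  finally show ?thesis .
qed

text \<open>This is the previous case reflected: \<open>K\<close> is invariant under changing the signs of both
  \<open>b\<close> and \<open>r\<close>, while \<open>\<sigma>\<close> is odd in \<open>b\<close>.\<close>

lemma diagonal_kernel_neg_iff_neg:
  assumes "a\<^sup>2 < b\<^sup>2" "a \<noteq> 0" "b < 0"
  shows "diagonal_kernel a b r < 0 \<longleftrightarrow> r < sigma_refl a b"
proof -
  define w where "w = sqrt (b\<^sup>2 - a\<^sup>2)"
  have "0 < w" using assms by (simp add: w_def)
  have "w < - b" using assms unfolding w_def by (intro real_less_lsqrt) auto
  with \<open>0 < w\<close> have "\<bar>w / (- b)\<bar> < 1" using \<open>b < 0\<close> by (simp add: field_simps)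
  then have "sigma_refl a (- b) = - sigma_refl a b"
    using artanh_minus_real[of "w / (- b)"] by (simp add: sigma_refl_def w_def)
  moreover have "diagonal_kernel a b r = diagonal_kernel a (- b) (- r)"
    by (simp add: diagonal_kernel_def)
  ultimately show ?thesis
    using diagonal_kernel_neg_iff_pos[of a "- b" "- r"] assms by auto
qed

section \<open>Rows of the Green's function\<close>

lemma greens_function_row_nonneg:
  assumes ab: "a\<^sup>2 < b\<^sup>2"
    and uv: "reflection_solution a b u" "reflection_solution (- a) b v"
    and a: "0 < a" and t: "0 \<le> t"
    and K: "\<And>r. 0 \<le> r \<Longrightarrow> r \<le> t \<Longrightarrow> 0 \<le> diagonal_kernel a b r"
  shows "0 \<le> greens_function u v t s"
proof -
  have "0 \<le> diagonal_kernel a b (t - s) * oriented_char 0 t s"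
    using K[of "t - s"] t by (auto simp: oriented_char_def)
  moreover have "0 \<le> reflected_kernel a b (s + t) * oriented_char (- t) 0 s"
    using a t by (auto simp: oriented_char_def reflected_kernel_nonneg_iff[OF ab])
  ultimately show ?thesis
    unfolding greens_function_closed_form[OF ab uv] by simp
qed

lemma greens_function_row_nonpos:
  assumes ab: "a\<^sup>2 < b\<^sup>2"
    and uv: "reflection_solution a b u" "reflection_solution (- a) b v"
    and a: "a < 0" and t: "t \<le> 0" and ts: "(t, s) \<noteq> (0, 0)"
    and K: "\<And>r. t \<le> r \<Longrightarrow> r \<le> 0 \<Longrightarrow> 0 \<le> diagonal_kernel a b r"
  shows "greens_function u v t s \<le> 0"
proof -
  have "diagonal_kernel a b (t - s) * oriented_char 0 t s \<le> 0"
    using K[of "t - s"] t ts by (auto simp: oriented_char_def)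
  moreover have "reflected_kernel a b (s + t) * oriented_char (- t) 0 s \<le> 0"
    using a t ts
    by (auto simp: oriented_char_def reflected_kernel_nonneg_iff[OF ab] zero_le_mult_iff)
  ultimately show ?thesis
    unfolding greens_function_closed_form[OF ab uv] by simp
qed

lemma greens_function_diagonal:
  assumes "a\<^sup>2 < b\<^sup>2" "reflection_solution a b u" "reflection_solution (- a) b v" "t \<noteq> 0"
  shows "greens_function u v t t = sgn t"
  using \<open>t \<noteq> 0\<close> unfolding greens_function_closed_form[OF assms(1-3)]
  by (auto simp: oriented_char_def)

text \<open>On the diagonal the Green's function has the sign of \<open>t\<close>, inside the reflected
  triangle that of \<open>a\<close>. If \<open>a\<close> and \<open>t\<close> have opposite signs, the two clash; if not, a negative value
  of \<open>K\<close> strictly between \<open>0\<close> and \<open>t\<close> clashes with the diagonal.\<close>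

lemma greens_function_row_changes_sign:
  assumes ab: "a\<^sup>2 < b\<^sup>2"
    and uv: "reflection_solution a b u" "reflection_solution (- a) b v"
    and t: "t \<noteq> 0"
    and bad: "a * t < 0 \<or>
      (\<exists>r. diagonal_kernel a b r < 0 \<and> (0 < r \<and> r < t \<or> t < r \<and> r < 0))"
  shows "(\<exists>s. 0 < greens_function u v t s) \<and> (\<exists>s. greens_function u v t s < 0)"
proof -
  have "\<exists>s. greens_function u v t s * sgn t < 0"
    using bad
  proof
    assume at: "a * t < 0"
    \<comment> \<open>the midpoint keeps \<open>s\<close> off the axis \<open>s = 0\<close>, where both terms contribute if \<open>t > 0\<close>\<close>
    have "greens_function u v t (- t / 2) = reflected_kernel a b (t / 2) * sgn t"
      using t unfolding greens_function_closed_form[OF ab uv]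
      by (auto simp: oriented_char_def)
    moreover have "reflected_kernel a b (t / 2) < 0"
      using reflected_kernel_neg_iff[OF ab] at by simp
    ultimately show ?thesis
      using t by (intro exI[of _ "- t / 2"]) (auto simp: sgn_if)
  next
    assume "\<exists>r. diagonal_kernel a b r < 0 \<and> (0 < r \<and> r < t \<or> t < r \<and> r < 0)"
    then obtain r where r: "diagonal_kernel a b r < 0" "0 < r \<and> r < t \<or> t < r \<and> r < 0"
      by blast
    then have "greens_function u v t (t - r) = diagonal_kernel a b r * sgn t"
      unfolding greens_function_closed_form[OF ab uv] by (auto simp: oriented_char_def)
    then show ?thesis
      using r t by (intro exI[of _ "t - r"]) (auto simp: sgn_if)
  qed
  then obtain s where s: "greens_function u v t s * sgn t < 0" by blast
  have d: "greens_function u v t t = sgn t"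
    by (rule greens_function_diagonal[OF ab uv t])
  show ?thesis
  proof (cases "0 < t")
    case True
    then have "0 < greens_function u v t t" "greens_function u v t s < 0"
      using s d by simp_all
    then show ?thesis by blast
  next
    case False
    then have "greens_function u v t t < 0" "0 < greens_function u v t s"
      using s d t by simp_all
    then show ?thesis by blast
  qed
qed

section \<open>Strips of constant sign\<close>

theorem lemma3p4:
  fixes a b :: real and u v :: "real \<Rightarrow> real" and G :: "real \<Rightarrow> real \<Rightarrow> real"
  assumes "a\<^sup>2 < b\<^sup>2"
    and "reflection_solution a b u"
    and "reflection_solution (- a) b v"
    and "G = greens_function u v"
  shows
    "(0 < a \<and> a < b \<longrightarrow> nonneg_on G ({0..sigma_refl a b} \<times> UNIV)) \<and>
     (b < - a \<and> - a < 0 \<longrightarrow> nonneg_on G ({0..} \<times> UNIV)) \<and>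
     (b < a \<and> a < 0 \<longrightarrow> nonpos_on G ({sigma_refl a b..0} \<times> UNIV - {(0, 0)})) \<and>
     (- a < b \<and> 0 < - a \<longrightarrow> nonpos_on G ({..0} \<times> UNIV - {(0, 0)})) \<and>
     (\<forall>S. strip S \<longrightarrow>
        (0 < a \<and> a < b \<and> \<not> S \<subseteq> {0..sigma_refl a b} \<times> UNIV \<or>
         b < - a \<and> - a < 0 \<and> \<not> S \<subseteq> {0..} \<times> UNIV \<or>
         b < a \<and> a < 0 \<and> \<not> S \<subseteq> {sigma_refl a b..0} \<times> UNIV \<or>
         - a < b \<and> 0 < - a \<and> \<not> S \<subseteq> {..0} \<times> UNIV) \<longrightarrow>
        changes_sign_on G (S - {(0, 0)}))"
proof -
  let ?K = "diagonal_kernel a b" and ?\<sigma> = "sigma_refl a b"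
  note nonneg = greens_function_row_nonneg[OF assms(1-3), folded assms(4)]
  note nonpos = greens_function_row_nonpos[OF assms(1-3), folded assms(4)]
  note changes = greens_function_row_changes_sign[OF assms(1-3), folded assms(4)]
  have Kpos: "?K r < 0 \<longleftrightarrow> ?\<sigma> < r" if "a \<noteq> 0" "0 < b" for r
    using diagonal_kernel_neg_iff_pos[OF assms(1) that] .
  have Kneg: "?K r < 0 \<longleftrightarrow> r < ?\<sigma>" if "a \<noteq> 0" "b < 0" for r
    using diagonal_kernel_neg_iff_neg[OF assms(1) that] .
  \<comment> \<open>\<open>K 0 = 1\<close> is positive, which locates the origin relative to \<open>\<sigma>\<close>\<close>
  have \<sigma>pos: "0 \<le> ?\<sigma>" if "a \<noteq> 0" "0 < b"
    using Kpos[OF that, of 0] by simp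
  have \<sigma>neg: "?\<sigma> \<le> 0" if "a \<noteq> 0" "b < 0"
    using Kneg[OF that, of 0] by simp
  have "nonneg_on G ({0..?\<sigma>} \<times> UNIV)" if "0 < a" "a < b"
  proof -
    have "0 \<le> ?K r" if "r \<le> ?\<sigma>" for r
      using that Kpos[of r] \<open>0 < a\<close> \<open>a < b\<close> by linarith
    then show ?thesis
      using that by (auto simp: nonneg_on_def intro: nonneg)
  qed
  moreover have "nonneg_on G ({0..} \<times> UNIV)" if "b < - a" "- a < 0"
  proof -
    have "0 \<le> ?K r" if "0 \<le> r" for r
      using that Kneg[of r] \<sigma>neg \<open>b < - a\<close> \<open>- a < 0\<close> by linarith
    then show ?thesis
      using that by (auto simp: nonneg_on_def intro: nonneg)
  qed
  moreover have "nonpos_on G ({?\<sigma>..0} \<times> UNIV - {(0, 0)})" if "b < a" "a < 0"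
  proof -
    have "0 \<le> ?K r" if "?\<sigma> \<le> r" for r
      using that Kneg[of r] \<open>b < a\<close> \<open>a < 0\<close> by linarith
    then show ?thesis
      using that by (auto simp: nonpos_on_def intro: nonpos)
  qed
  moreover have "nonpos_on G ({..0} \<times> UNIV - {(0, 0)})" if "- a < b" "0 < - a"
  proof -
    have "0 \<le> ?K r" if "r \<le> 0" for r
      using that Kpos[of r] \<sigma>pos \<open>- a < b\<close> \<open>0 < - a\<close> by linarith
    then show ?thesis
      using that by (auto simp: nonpos_on_def intro: nonpos)
  qed
  moreover have "changes_sign_on G (S - {(0, 0)})"
    if S: "strip S" and out:
      "0 < a \<and> a < b \<and> \<not> S \<subseteq> {0..?\<sigma>} \<times> UNIV \<or>
       b < - a \<and> - a < 0 \<and> \<not> S \<subseteq> {0..} \<times> UNIV \<or>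
       b < a \<and> a < 0 \<and> \<not> S \<subseteq> {?\<sigma>..0} \<times> UNIV \<or>
       - a < b \<and> 0 < - a \<and> \<not> S \<subseteq> {..0} \<times> UNIV" for S
  proof -
    obtain T where T: "S = T \<times> UNIV" using S by (auto simp: strip_def)
    have "\<exists>t\<in>T. a * t < 0 \<or> 0 < b \<and> a \<noteq> 0 \<and> ?\<sigma> < t \<or> b < 0 \<and> a \<noteq> 0 \<and> t < ?\<sigma>"
      using out unfolding T by (force simp: mult_less_0_iff not_le)
    then obtain t where "t \<in> T" and
      "a * t < 0 \<or> 0 < b \<and> a \<noteq> 0 \<and> ?\<sigma> < t \<or> b < 0 \<and> a \<noteq> 0 \<and> t < ?\<sigma>" by blast
    then consider "a * t < 0" | "0 < b" "a \<noteq> 0" "?\<sigma> < t" | "b < 0" "a \<noteq> 0" "t < ?\<sigma>"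
      by blast
    then have "t \<noteq> 0 \<and> (a * t < 0 \<or> (\<exists>r. ?K r < 0 \<and> (0 < r \<and> r < t \<or> t < r \<and> r < 0)))"
    proof cases
      case 1
      then show ?thesis by auto
    next
      case 2
      then have "?K ((?\<sigma> + t) / 2) < 0" "0 < (?\<sigma> + t) / 2" "(?\<sigma> + t) / 2 < t" "t \<noteq> 0"
        using Kpos \<sigma>pos by simp_all
      then show ?thesis by blast
    next
      case 3
      then have "?K ((?\<sigma> + t) / 2) < 0" "(?\<sigma> + t) / 2 < 0" "t < (?\<sigma> + t) / 2" "t \<noteq> 0"
        using Kneg \<sigma>neg by simp_all
      then show ?thesis by blast
    qed
    with changes[of t] show ?thesis
      using \<open>t \<in> T\<close> unfolding changes_sign_on_def T by blast
  qed
  ultimately show ?thesis by blast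
qed

end
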